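(* Let $X$ be a nonempty finite set and let $B\in\mathrm{Mat}_X(\mathbb{R})$ be a nonnegative irreducible matrix. Let $\mathcal{B}=\{p(B)\mid p\in\mathbb{C}[t]\}$ be the complex vector space of all polynomials in $B$. Let $A$ be the $01$-matrix defined by $(A)_{xy}=1$ if and only if $(B)_{xy}>0$ $(x,y\in X)$, let $\Gamma=\Gamma(A)$ be the digraph with vertex set $X$ and adjacency matrix $A$, let $D$ be the diameter of $\Gamma$, and let $A_D$ be the distance-$D$ matrix of $\Gamma$. Then $\mathcal{B}$ is the Bose--Mesner algebra of a commutative $D$-class association scheme if and only if $B$ is a normal $\lambda$-doubly stochastic matrix (for some $\lambda\in\mathbb{R}$) with exactly $D+1$ distinct eigenvalues and $A_D$ is a polynomial in $B$ (i.e. $A_D\in\mathcal{B}$).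
   Context: $\mathrm{Mat}_X(\mathbb{R})$ and $\mathrm{Mat}_X(\mathbb{C})$ are the algebras of real, respectively complex, matrices with rows and columns indexed by $X$. A square matrix $B$ is reducible if there is a permutation matrix $P$ such that $P^\top BP=\begin{pmatrix}Y_1&Y_2\\ O&Y_3\end{pmatrix}$ with $Y_1,Y_3$ square (of positive size) and $O$ a zero block; otherwise it is irreducible. A nonnegative matrix $B$ is $\lambda$-doubly stochastic if $\sum_{z\in X}(B)_{yz}=\sum_{z\in X}(B)_{zy}=\lambda$ for every $y\in X$. A matrix $B$ is normal if it commutes with its conjugate transpose. Eigenvalues are complex eigenvalues. The digraph $\Gamma(A)$ has an arc from $x$ to $y$ exactly when $(A)_{xy}=1$; loops are allowed. Since $B$ is irreducible, $\Gamma(A)$ is strongly connected. The distance $\partial(x,y)$ from $x$ to $y$ is the length of a shortest directed path from $x$ to $y$ (so $\partial(x,x)=0$), and the diameter is $D=\max\{\partial(x,y)\mid x,y\in X\}$. The distance-$i$ matrix $A_i$ is the $01$-matrix with $(A_i)_{xy}=1$ if and only if $\partial(x,y)=i$. A commutative $d$-class association scheme on $X$ is a pair $(X,\{R_0,\dots,R_d\})$, where $R_0,\dots,R_d$ are nonempty subsets of $X\times X$ whose $01$ adjacency matrices $B_0,\dots,B_d\in\mathrm{Mat}_X(\mathbb{C})$ (with $(B_i)_{xy}=1$ iff $(x,y)\in R_i$) satisfy: $B_0=I$; $\sum_{i=0}^d B_i=J$ (the all-ones matrix); $B_i^\top\in\{B_0,\dots,B_d\}$ for all $i$; $B_iB_j$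 is a linear combination of $B_0,\dots,B_d$ for all $i,j$; and $B_iB_j=B_jB_i$ for all $i,j$. Its Bose--Mesner algebra is the complex span of $B_0,\dots,B_d$. *)

theory Defs
  imports "HOL-Analysis.Analysis" "HOL-Computational_Algebra.Polynomial"
begin

(* Matrices indexed by X are elements of 'a^'n^'n, where the finite (and automatically
   nonempty) type 'n plays the role of X. *)

section \<open>Matrices\<close>

definition permutation_matrix :: "real^'n^'n \<Rightarrow> bool" where
  "permutation_matrix P \<longleftrightarrow>
     (\<exists>p. p permutes UNIV \<and> P = (\<chi> x y. of_bool (x = p y)))"

(* The index type carries no order, so the block form of transpose P ** B ** P is read off
   along an enumeration e of the indices. The first block consists of the first k positions;
   0 < k < CARD('n) says that both diagonal blocks have positive size, and the last conjunct
   that the lower left block is zero. *)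
definition reducible_matrix :: "real^'n^'n \<Rightarrow> bool" where
  "reducible_matrix B \<longleftrightarrow>
     (\<exists>P (e :: nat \<Rightarrow> 'n) k. permutation_matrix P \<and> bij_betw e {..<CARD('n)} UNIV \<and>
        0 < k \<and> k < CARD('n) \<and>
        (\<forall>i\<in>{k..<CARD('n)}. \<forall>j<k. (transpose P ** B ** P) $ e i $ e j = 0))"

definition irreducible_matrix :: "real^'n^'n \<Rightarrow> bool" where
  "irreducible_matrix B \<longleftrightarrow> \<not> reducible_matrix B"

definition nonneg_matrix :: "real^'n^'n \<Rightarrow> bool" where
  "nonneg_matrix B \<longleftrightarrow> (\<forall>x y. 0 \<le> B $ x $ y)"

definition doubly_stochastic :: "real \<Rightarrow> real^'n^'n \<Rightarrow> bool" where
  "doubly_stochastic r B \<longleftrightarrow>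
     nonneg_matrix B \<and> (\<forall>y. (\<Sum>z\<in>UNIV. B $ y $ z) = r \<and> (\<Sum>z\<in>UNIV. B $ z $ y) = r)"

abbreviation complex_matrix :: "real^'n^'n \<Rightarrow> complex^'n^'n" where
  "complex_matrix \<equiv> map_matrix complex_of_real"

definition conj_transpose :: "complex^'n^'n \<Rightarrow> complex^'n^'n" where
  "conj_transpose M = transpose (map_matrix cnj M)"

definition normal_matrix :: "complex^'n^'n \<Rightarrow> bool" where
  "normal_matrix M \<longleftrightarrow> M ** conj_transpose M = conj_transpose M ** M"

definition eigenvalues :: "complex^'n^'n \<Rightarrow> complex set" where
  "eigenvalues M = {\<theta>. \<exists>v. v \<noteq> 0 \<and> M *v v = \<theta> *s v}"

(* The ring operations that the library puts on vector types are componentwise, and the scalars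
   of *s are vector entries (here rows), so complex scaling and powers of square matrices are
   introduced here. *)
definition smult_matrix :: "complex \<Rightarrow> complex^'n^'n \<Rightarrow> complex^'n^'n" where
  "smult_matrix c M = map_matrix ((*) c) M"

definition matrix_power :: "complex^'n^'n \<Rightarrow> nat \<Rightarrow> complex^'n^'n" where
  "matrix_power M k = (((**) M) ^^ k) (mat 1)"

definition matrix_poly :: "complex poly \<Rightarrow> complex^'n^'n \<Rightarrow> complex^'n^'n" where
  "matrix_poly p M = (\<Sum>k\<le>degree p. smult_matrix (coeff p k) (matrix_power M k))"

definition polynomial_algebra :: "complex^'n^'n \<Rightarrow> (complex^'n^'n) set" where
  "polynomial_algebra M = {matrix_poly p M | p. True}"

definition relation_matrix :: "('n \<times> 'n) set \<Rightarrow> ('a::zero_neq_one)^'n^'n" where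
  "relation_matrix R = (\<chi> x y. if (x, y) \<in> R then 1 else 0)"


section \<open>Digraphs\<close>

definition support_matrix :: "real^'n^'n \<Rightarrow> real^'n^'n" where
  "support_matrix B = (\<chi> x y. if B $ x $ y > 0 then 1 else 0)"

(* Arcs, paths and distances are those of the digraph with adjacency matrix A. *)
definition arc_of :: "real^'n^'n \<Rightarrow> 'n \<Rightarrow> 'n \<Rightarrow> bool" where
  "arc_of A x y \<longleftrightarrow> A $ x $ y = 1"

(* A path is given by its list of vertices; its length is the number of arcs. *)
definition directed_path :: "real^'n^'n \<Rightarrow> 'n \<Rightarrow> 'n list \<Rightarrow> 'n \<Rightarrow> bool" where
  "directed_path A x vs y \<longleftrightarrow>
     vs \<noteq> [] \<and> hd vs = x \<and> last vs = y \<and> distinct vs \<and> successively (arc_of A) vs"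

(* The value is arbitrary if there is no path from x to y; this does not happen in strongly
   connected digraphs. *)
definition digraph_dist :: "real^'n^'n \<Rightarrow> 'n \<Rightarrow> 'n \<Rightarrow> nat" where
  "digraph_dist A x y = (LEAST l. \<exists>vs. directed_path A x vs y \<and> length vs = Suc l)"

definition digraph_diameter :: "real^'n^'n \<Rightarrow> nat" where
  "digraph_diameter A = Max {digraph_dist A x y | x y. True}"

definition distance_matrix :: "real^'n^'n \<Rightarrow> nat \<Rightarrow> ('a::zero_neq_one)^'n^'n" where
  "distance_matrix A i = relation_matrix {(x, y). digraph_dist A x y = i}"


section \<open>Commutative association schemes\<close>

(* The complex span of the adjacency matrices of R 0, ..., R d. *)
definition bose_mesner :: "nat \<Rightarrow> (nat \<Rightarrow> ('n \<times> 'n) set) \<Rightarrow> (complex^'n^'n) set" where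
  "bose_mesner d R = {\<Sum>i\<le>d. smult_matrix (c i) (relation_matrix (R i)) | c. True}"

(* Only the values R 0, ..., R d of the family R matter. *)
definition commutative_scheme :: "nat \<Rightarrow> (nat \<Rightarrow> ('n::finite \<times> 'n) set) \<Rightarrow> bool" where
  "commutative_scheme d R \<longleftrightarrow>
     (let M = (\<lambda>i. relation_matrix (R i) :: complex^'n^'n) in
        (\<forall>i\<le>d. R i \<noteq> {}) \<and>
        M 0 = mat 1 \<and>
        (\<Sum>i\<le>d. M i) = (\<chi> x y. 1) \<and>
        (\<forall>i\<le>d. transpose (M i) \<in> M ` {..d}) \<and>
        (\<forall>i\<le>d. \<forall>j\<le>d. M i ** M j \<in> bose_mesner d R) \<and>
        (\<forall>i\<le>d. \<forall>j\<le>d. M i ** M j = M j ** M i))"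

end

(* Matrix powers see distance: (B^k)_xy is nonzero iff there is a walk of length k from x to y, so
   I, B, ..., B^D are linearly independent. If B is normal, its minimal polynomial is squarefree,
   hence its degree, which is the dimension of the algebra of polynomials in B, is the number of
   eigenvalues.

   Given a scheme, commuting with J makes B doubly stochastic, closure under transposition makes
   it normal, and the dimension D + 1 counts the eigenvalues. All powers of B are constant on each
   relation, hence so is the distance, and A_D is a sum of adjacency matrices.

   Conversely, normality puts B^* into the algebra (Lagrange interpolation) and the maximum
   principle puts J there. For every i the matrices I, ..., B^(i-1), (B^(D-i))^* A_D, ..., B^* A_D, A_D
   are triangular with respect to the distance, hence a basis of the algebra. Expanding J in this
   basis separates the pairs at distance less than i from the others, so A_0 + ... + A_(i-1) lies in
   the algebra. Thus A_0, ..., A_D is a basis of 01-matrices and gives the scheme. *)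
theory Submission
  imports Defs "HOL-Computational_Algebra.Fundamental_Theorem_Algebra"
begin

section \<open>Polynomials in a matrix\<close>

lemma smult_matrix_nth [simp]: "smult_matrix c M $ x $ y = c * M $ x $ y"
  by (simp add: smult_matrix_def map_matrix_def)

text \<open>Provides complex linear algebra (\<open>span\<close>, \<open>subspace\<close>,
  \<open>dependent\<close>) for whole matrices, with \<open>smult_matrix\<close> as scaling.\<close>

interpretation matrix_space: vector_space "smult_matrix :: complex \<Rightarrow> complex^'n^'n \<Rightarrow> complex^'n^'n"
  by unfold_locales (simp_all add: vec_eq_iff algebra_simps)

lemma smult_matrix_mult_left: "smult_matrix c M ** N = smult_matrix c (M ** N)"
  by (simp add: vec_eq_iff matrix_matrix_mult_def sum_distrib_left mult.assoc)

lemma smult_matrix_mult_right: "M ** smult_matrix c N = smult_matrix c (M ** N)"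
  by (simp add: vec_eq_iff matrix_matrix_mult_def sum_distrib_left mult.left_commute)

lemma matrix_add_rdistrib: "(A + B) ** C = A ** C + B ** C"
  for A B :: "'a::semiring_1^'n^'m"
  by (simp add: vec_eq_iff matrix_matrix_mult_def distrib_right sum.distrib)

lemma matrix_diff_rdistrib: "(A - B) ** C = A ** C - B ** C"
  for A B :: "'a::ring_1^'n^'m"
  by (simp add: vec_eq_iff matrix_matrix_mult_def left_diff_distrib sum_subtractf)

lemma matrix_mult_zero_left [simp]: "0 ** M = 0"
  by (simp add: vec_eq_iff matrix_matrix_mult_def)

lemma matrix_mult_zero_right [simp]: "M ** 0 = 0"
  by (simp add: vec_eq_iff matrix_matrix_mult_def)

lemma matrix_power_0 [simp]: "matrix_power M 0 = mat 1"
  by (simp add: matrix_power_def)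

lemma matrix_power_Suc: "matrix_power M (Suc k) = M ** matrix_power M k"
  by (simp add: matrix_power_def)

text \<open>Padding with zero coefficients brings polynomials of different degrees to a common
  summation range.\<close>

lemma matrix_poly_eq_sum:
  assumes "degree p \<le> n"
  shows "matrix_poly p M = (\<Sum>k\<le>n. smult_matrix (coeff p k) (matrix_power M k))"
  unfolding matrix_poly_def
  by (rule sum.mono_neutral_left) (use assms in \<open>auto simp: coeff_eq_0\<close>)

lemma matrix_poly_0 [simp]: "matrix_poly 0 M = 0"
  by (simp add: matrix_poly_def)

lemma matrix_poly_add: "matrix_poly (p + q) M = matrix_poly p M + matrix_poly q M"
proof -
  define n where "n = max (degree p) (degree q)"
  have "degree (p + q) \<le> n" "degree p \<le> n" "degree q \<le> n"
    by (auto simp: n_def degree_add_le_max)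
  then show ?thesis
    by (simp add: matrix_poly_eq_sum[of _ n] matrix_space.scale_left_distrib sum.distrib)
qed

lemma matrix_poly_sum: "matrix_poly (\<Sum>i\<in>I. f i) M = (\<Sum>i\<in>I. matrix_poly (f i) M)"
  by (induction I rule: infinite_finite_induct) (simp_all add: matrix_poly_add)

lemma matrix_poly_smult: "matrix_poly (smult c p) M = smult_matrix c (matrix_poly p M)"
  by (subst matrix_poly_eq_sum[of _ "degree p"])
    (simp_all add: degree_smult_le matrix_poly_def matrix_space.scale_sum_right)

lemma matrix_mult_sum_right: "M ** (\<Sum>k\<in>I. f k) = (\<Sum>k\<in>I. M ** f k)"
  by (induction I rule: infinite_finite_induct) (simp_all add: matrix_add_ldistrib)

text \<open>Horner's rule, the recursion behind the inductions over polynomials below.\<close>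

lemma matrix_poly_pCons:
  "matrix_poly (pCons a p) M = smult_matrix a (mat 1) + M ** matrix_poly p M"
proof -
  have "matrix_poly (pCons a p) M =
      (\<Sum>k\<le>Suc (degree p). smult_matrix (coeff (pCons a p) k) (matrix_power M k))"
    by (rule matrix_poly_eq_sum) (simp add: degree_pCons_le)
  also have "\<dots> = smult_matrix a (mat 1) +
      (\<Sum>k\<le>degree p. smult_matrix (coeff p k) (M ** matrix_power M k))"
    by (subst sum.atMost_Suc_shift) (simp add: matrix_power_Suc)
  finally show ?thesis
    by (simp add: matrix_poly_def matrix_mult_sum_right smult_matrix_mult_right)
qed

lemma matrix_poly_1 [simp]: "matrix_poly 1 M = mat 1"
  by (simp add: one_pCons matrix_poly_pCons)

lemma matrix_poly_X: "matrix_poly [:a, 1:] M = smult_matrix a (mat 1) + M"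
  by (simp add: matrix_poly_pCons)

lemma matrix_poly_mult: "matrix_poly (p * q) M = matrix_poly p M ** matrix_poly q M"
  by (induction p)
    (simp_all add: matrix_poly_pCons matrix_poly_add matrix_poly_smult matrix_add_rdistrib
      smult_matrix_mult_left matrix_mul_assoc)

lemma matrix_poly_monom: "matrix_poly (monom 1 k) M = matrix_power M k"
  by (induction k) (simp_all add: monom_0 monom_Suc matrix_poly_pCons matrix_power_Suc)

lemma matrix_poly_commute:
  assumes "C ** M = M ** C"
  shows "C ** matrix_poly p M = matrix_poly p M ** C"
proof (induction p)
  case (pCons a p)
  have "C ** (M ** matrix_poly p M) = M ** matrix_poly p M ** C"
    by (metis assms matrix_mul_assoc pCons.IH)
  then show ?case
    by (simp add: matrix_poly_pCons matrix_add_rdistrib matrix_add_ldistrib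
        smult_matrix_mult_left smult_matrix_mult_right)
qed auto

lemma matrix_poly_vector:
  fixes v :: "complex^'n"
  assumes "M *v v = \<theta> *s v"
  shows "matrix_poly p M *v v = poly p \<theta> *s v"
proof (induction p)
  case (pCons a p)
  have "smult_matrix a (mat 1) *v v = a *s v"
    by (simp add: vec_eq_iff matrix_vector_mult_def mat_def if_distrib[of "\<lambda>c. a * c * _"] mult.assoc
        if_distribR if_distrib[of "\<lambda>c. c * _"] if_distrib[of "\<lambda>c. a * c"] cong: if_cong)
  moreover have "(M ** matrix_poly p M) *v v = (\<theta> * poly p \<theta>) *s v"
    using pCons.IH assms
    by (simp flip: matrix_vector_mul_assoc add: matrix_vector_mult_scaleR vector_scalar_commute
        mult.commute)
  ultimately show ?case
    by (simp add: matrix_poly_pCons matrix_vector_mult_add_rdistrib vector_sadd_rdistrib)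
qed auto

lemma polynomial_algebra_eq_range: "polynomial_algebra M = range (\<lambda>p. matrix_poly p M)"
  by (auto simp: polynomial_algebra_def)

lemma subspace_polynomial_algebra: "matrix_space.subspace (polynomial_algebra M)"
  unfolding matrix_space.subspace_def polynomial_algebra_eq_range
  by (auto simp flip: matrix_poly_add matrix_poly_smult intro: range_eqI[of _ _ 0])

lemma polynomial_algebra_mult:
  assumes "P \<in> polynomial_algebra M" "Q \<in> polynomial_algebra M"
  shows "P ** Q \<in> polynomial_algebra M"
  using assms unfolding polynomial_algebra_eq_range by (auto simp flip: matrix_poly_mult)

lemma polynomial_algebra_commute:
  assumes "P \<in> polynomial_algebra M" "Q \<in> polynomial_algebra M"
  shows "P ** Q = Q ** P"
  using assms unfolding polynomial_algebra_eq_range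
  by (auto simp flip: matrix_poly_mult simp: mult.commute)

lemma matrix_power_in_polynomial_algebra: "matrix_power M k \<in> polynomial_algebra M"
  unfolding polynomial_algebra_eq_range by (metis matrix_poly_monom rangeI)

lemma matrix_in_polynomial_algebra: "M \<in> polynomial_algebra M"
  using matrix_power_in_polynomial_algebra[of M 1] by (simp add: matrix_power_Suc)

section \<open>Linear dependence\<close>

text \<open>More members than spanning matrices force a relation. It is a relation between indices,
  so that repeated members count as dependent.\<close>

lemma matrix_family_dependent:
  fixes f :: "nat \<Rightarrow> complex^'n^'n"
  assumes "finite T" "card T \<le> n" "\<And>k. k \<le> n \<Longrightarrow> f k \<in> matrix_space.span T"
  obtains c where "\<exists>k\<le>n. c k \<noteq> 0" "(\<Sum>k\<le>n. smult_matrix (c k) (f k)) = 0"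
proof (cases "inj_on f {..n}")
  case True
  have "matrix_space.dependent (f ` {..n})"
  proof (rule ccontr)
    assume "\<not> ?thesis"
    then have "card (f ` {..n}) \<le> card T"
      using matrix_space.independent_span_bound[of T "f ` {..n}"] assms by auto
    then show False
      using assms(2) by (simp add: card_image True)
  qed
  then obtain u where u: "\<exists>v\<in>f ` {..n}. u v \<noteq> 0" "(\<Sum>v\<in>f ` {..n}. smult_matrix (u v) v) = 0"
    by (subst (asm) matrix_space.dependent_finite) auto
  then have "(\<Sum>k\<le>n. smult_matrix (u (f k)) (f k)) = 0"
    by (simp add: sum.reindex True)
  with u(1) show ?thesis
    by (intro that[of "\<lambda>k. u (f k)"]) auto
next
  case False
  then obtain i j where ij: "i \<le> n" "j \<le> n" "i \<noteq> j" "f i = f j"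
    by (auto simp: inj_on_def)
  \<comment> \<open>A repetition gives the relation \<open>f i - f j = 0\<close>, which the image
    set alone would not show.\<close>
  let ?c = "\<lambda>k. if k = i then 1 else if k = j then -1 else 0 :: complex"
  have "(\<Sum>k\<le>n. smult_matrix (?c k) (f k)) =
      (\<Sum>k\<le>n. (if k = i then f i else 0) + (if k = j then - f j else 0))"
    using ij by (intro sum.cong) auto
  also have "\<dots> = 0"
    using ij by (simp add: sum.distrib)
  finally show ?thesis
    using ij by (intro that[of ?c]) auto
qed

text \<open>Exchange argument: with \<open>v\<close> put at index \<open>n\<close> there is one
  matrix too many. In the resulting relation independence of the others makes the coefficient of
  \<open>v\<close> nonzero, so it can be solved for \<open>v\<close>.\<close>

lemma matrix_family_spanning:
  fixes f :: "nat \<Rightarrow> complex^'n^'n"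
  assumes "finite T" "card T \<le> n" "\<And>k. k < n \<Longrightarrow> f k \<in> matrix_space.span T"
    and independent: "\<And>c. (\<Sum>k<n. smult_matrix (c k) (f k)) = 0 \<Longrightarrow> \<forall>k<n. c k = 0"
    and "v \<in> matrix_space.span T"
  obtains c where "v = (\<Sum>k<n. smult_matrix (c k) (f k))"
proof -
  have "\<And>k. k \<le> n \<Longrightarrow> (f(n := v)) k \<in> matrix_space.span T"
    using assms by auto
  then obtain c where c: "\<exists>k\<le>n. c k \<noteq> 0" "(\<Sum>k\<le>n. smult_matrix (c k) ((f(n := v)) k)) = 0"
    using matrix_family_dependent[of T n "f(n := v)"] assms(1,2) by blast
  have eq: "(\<Sum>k<n. smult_matrix (c k) (f k)) + smult_matrix (c n) v = 0"
    using c(2) by (simp flip: lessThan_Suc_atMost)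
  have "c n \<noteq> 0"
  proof
    assume "c n = 0"
    with eq have "\<forall>k<n. c k = 0"
      by (intro independent) simp
    with \<open>c n = 0\<close> c(1) show False
      by (metis le_neq_implies_less)
  qed
  have "(\<Sum>k<n. smult_matrix (c k) (f k)) = smult_matrix (- c n) v"
    using eq by (simp add: eq_neg_iff_add_eq_0)
  then have "v = smult_matrix (- inverse (c n)) (\<Sum>k<n. smult_matrix (c k) (f k))"
    using \<open>c n \<noteq> 0\<close> by simp
  then show ?thesis
    by (intro that[of "\<lambda>k. - inverse (c n) * c k"]) (simp add: matrix_space.scale_sum_right)
qed

text \<open>The matrix units span.\<close>

lemma finite_spanning_set:
  obtains T :: "(complex^'n^'n) set" where "finite T" "matrix_space.span T = UNIV"
proof -
  let ?E = "\<lambda>(a, b). (\<chi> x y. if x = a \<and> y = b then 1 else 0) :: complex^'n^'n"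
  have "M \<in> matrix_space.span (range ?E)" for M :: "complex^'n^'n"
  proof -
    have "M = (\<Sum>p\<in>UNIV. smult_matrix (M $ fst p $ snd p) (?E p))"
    proof (clarsimp simp: vec_eq_iff)
      fix x y
      have "(\<Sum>p\<in>UNIV. M $ fst p $ snd p * ?E p $ x $ y) =
          (\<Sum>p\<in>UNIV. if p = (x, y) then M $ x $ y else 0)"
        by (intro sum.cong) (auto simp: prod_eq_iff split: if_splits)
      then show "M $ x $ y = (\<Sum>p\<in>UNIV. M $ fst p $ snd p * ?E p $ x $ y)"
        by simp
    qed
    also have "\<dots> \<in> matrix_space.span (range ?E)"
      by (intro matrix_space.span_sum matrix_space.span_scale matrix_space.span_base) auto
    finally show ?thesis .
  qed
  then show ?thesis
    by (intro that[of "range ?E"]) auto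
qed

section \<open>Normal matrices\<close>

lemma conj_transpose_nth [simp]: "conj_transpose M $ x $ y = cnj (M $ y $ x)"
  by (simp add: conj_transpose_def transpose_def map_matrix_def)

lemma conj_transpose_conj_transpose [simp]: "conj_transpose (conj_transpose M) = M"
  by (simp add: vec_eq_iff)

lemma conj_transpose_0 [simp]: "conj_transpose 0 = 0"
  by (simp add: vec_eq_iff)

lemma conj_transpose_1 [simp]: "conj_transpose (mat 1) = mat 1"
  by (simp add: vec_eq_iff mat_def)

lemma conj_transpose_add: "conj_transpose (M + N) = conj_transpose M + conj_transpose N"
  by (simp add: vec_eq_iff)

lemma conj_transpose_diff: "conj_transpose (M - N) = conj_transpose M - conj_transpose N"
  by (simp add: vec_eq_iff)

lemma conj_transpose_smult: "conj_transpose (smult_matrix c M) = smult_matrix (cnj c) (conj_transpose M)"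
  by (simp add: vec_eq_iff)

lemma conj_transpose_mult: "conj_transpose (M ** N) = conj_transpose N ** conj_transpose M"
  by (simp add: vec_eq_iff matrix_matrix_mult_def mult.commute)

text \<open>The diagonal entries of the product are the squared norms of the columns of
  \<open>X\<close>.\<close>

lemma conj_transpose_mult_self_eq_0:
  assumes "conj_transpose X ** X = 0"
  shows "X = 0"
proof -
  have "X $ x $ y = 0" for x y
  proof -
    have "complex_of_real (\<Sum>z\<in>UNIV. (cmod (X $ z $ y))\<^sup>2) = (conj_transpose X ** X) $ y $ y"
      by (simp add: matrix_matrix_mult_def complex_norm_square mult.commute del: of_real_power)
    also have "\<dots> = 0"
      using assms by simp
    finally have "(\<Sum>z\<in>UNIV. (cmod (X $ z $ y))\<^sup>2) = 0"
      by (simp only: of_real_eq_0_iff)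
    then show ?thesis
      by (subst (asm) sum_nonneg_eq_0_iff) auto
  qed
  then show ?thesis
    by (simp add: vec_eq_iff)
qed

text \<open>\<open>N ** X\<close> and \<open>conj_transpose N ** X\<close> have the same Gram matrix
  when \<open>N\<close> is normal. Applied to \<open>M\<close> minus \<theta> times the identity,
  this turns eigenvectors of \<open>M\<close> for \<theta> into eigenvectors of the adjoint for
  \<open>cnj \<theta>\<close>.\<close>

lemma normal_matrix_annihilate:
  fixes N X :: "complex^'n^'n"
  assumes "normal_matrix N" "N ** X = 0"
  shows "conj_transpose N ** X = 0"
proof (rule conj_transpose_mult_self_eq_0)
  have "conj_transpose (conj_transpose N ** X) ** (conj_transpose N ** X) =
      conj_transpose X ** (N ** conj_transpose N) ** X"
    by (simp add: conj_transpose_mult matrix_mul_assoc)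
  also have "N ** conj_transpose N = conj_transpose N ** N"
    using assms(1) by (simp add: normal_matrix_def)
  also have "conj_transpose X ** (conj_transpose N ** N) ** X =
      conj_transpose X ** conj_transpose N ** (N ** X)"
    by (simp add: matrix_mul_assoc)
  finally show "conj_transpose (conj_transpose N ** X) ** (conj_transpose N ** X) = 0"
    using assms(2) by simp
qed

text \<open>This excludes multiple roots of the minimal polynomial of a normal matrix.\<close>

lemma normal_matrix_square_eq_0:
  assumes "normal_matrix N" "N ** N = 0"
  shows "N = 0"
  by (rule conj_transpose_mult_self_eq_0) (rule normal_matrix_annihilate[OF assms])

text \<open>Commuting with \<open>M\<close> passes to polynomials in \<open>M\<close>. This is used
  twice, with an adjoint taken in between.\<close>

lemma normal_matrix_poly:
  assumes "normal_matrix M"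
  shows "normal_matrix (matrix_poly p M)"
proof -
  have "conj_transpose M ** matrix_poly p M = matrix_poly p M ** conj_transpose M"
    using assms by (intro matrix_poly_commute) (simp add: normal_matrix_def)
  then have "conj_transpose (matrix_poly p M) ** M = M ** conj_transpose (matrix_poly p M)"
    by (metis conj_transpose_mult conj_transpose_conj_transpose)
  then show ?thesis
    unfolding normal_matrix_def by (rule matrix_poly_commute[symmetric])
qed

section \<open>Minimal polynomials and eigenvalues\<close>

lemma annihilating_poly_of_span:
  fixes M :: "complex^'n^'n"
  assumes "finite T" "card T \<le> n" "\<And>k. matrix_power M k \<in> matrix_space.span T"
  obtains p where "p \<noteq> 0" "matrix_poly p M = 0" "degree p \<le> n"
proof -
  obtain c where c: "\<exists>k\<le>n. c k \<noteq> 0" "(\<Sum>k\<le>n. smult_matrix (c k) (matrix_power M k)) = 0"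
    using matrix_family_dependent[of T n "matrix_power M"] assms by blast
  define p where "p = (\<Sum>k\<le>n. monom (c k) k)"
  have coeff: "coeff p k = (if k \<le> n then c k else 0)" for k
    by (simp add: p_def coeff_sum coeff_monom)
  have "degree p \<le> n"
    unfolding p_def by (intro degree_sum_le) (auto intro: order.trans[OF degree_monom_le])
  moreover from this have "matrix_poly p M = 0"
    using c(2) by (simp add: matrix_poly_eq_sum[of p n] coeff)
  moreover have "p \<noteq> 0"
    using c(1) by (metis coeff coeff_0)
  ultimately show ?thesis
    using that by blast
qed

lemma ex_annihilating_poly:
  fixes M :: "complex^'n^'n"
  shows "\<exists>p. p \<noteq> 0 \<and> matrix_poly p M = 0"
proof -
  obtain T :: "(complex^'n^'n) set" where "finite T" "matrix_space.span T = UNIV"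
    by (rule finite_spanning_set)
  then show ?thesis
    using annihilating_poly_of_span[of T "card T" M] by auto
qed

lemma eigenvalue_imp_root:
  assumes "\<theta> \<in> eigenvalues M" "matrix_poly p M = 0"
  shows "poly p \<theta> = 0"
proof -
  obtain v where "v \<noteq> 0" "M *v v = \<theta> *s v"
    using assms(1) by (auto simp: eigenvalues_def)
  then have "poly p \<theta> *s v = 0"
    using matrix_poly_vector[of M v \<theta> p] assms(2) by simp
  with \<open>v \<noteq> 0\<close> show ?thesis
    by simp
qed

text \<open>The minimal polynomial up to a nonzero constant factor; the leading coefficient is left
  free.\<close>

definition min_annihilator :: "complex poly \<Rightarrow> complex^'n^'n \<Rightarrow> bool" where
  "min_annihilator g M \<longleftrightarrow> g \<noteq> 0 \<and> matrix_poly g M = 0 \<and>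
     (\<forall>h. h \<noteq> 0 \<longrightarrow> matrix_poly h M = 0 \<longrightarrow> degree g \<le> degree h)"

lemma ex_min_annihilator: "\<exists>g. min_annihilator g M"
  using ex_annihilating_poly[of M] ex_has_least_nat[of "\<lambda>p. p \<noteq> 0 \<and> matrix_poly p M = 0" _ degree]
  unfolding min_annihilator_def by blast

text \<open>The cofactor has smaller degree than \<open>g\<close> and so cannot annihilate
  \<open>M\<close>. The nonzero columns of its value are eigenvectors for \<theta>.\<close>

lemma min_annihilator_cofactor:
  assumes "min_annihilator g M" "g = [:-\<theta>, 1:] * h"
  shows "matrix_poly h M \<noteq> 0" "M ** matrix_poly h M = smult_matrix \<theta> (matrix_poly h M)"
proof -
  have "h \<noteq> 0"
    using assms by (auto simp: min_annihilator_def)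
  then have "degree g = Suc (degree h)"
    unfolding assms(2) by (subst degree_mult_eq) auto
  then show "matrix_poly h M \<noteq> 0"
    using assms(1) \<open>h \<noteq> 0\<close> unfolding min_annihilator_def by (metis not_less_eq_eq order_refl)
  have "matrix_poly [:-\<theta>, 1:] M ** matrix_poly h M = 0"
    using assms by (simp add: min_annihilator_def flip: matrix_poly_mult)
  then show "M ** matrix_poly h M = smult_matrix \<theta> (matrix_poly h M)"
    by (simp add: matrix_poly_X matrix_diff_rdistrib smult_matrix_mult_left)
qed

text \<open>At a root, a nonzero column of the cofactor's value is an eigenvector. Conversely, every
  annihilating polynomial vanishes at every eigenvalue.\<close>

lemma min_annihilator_roots:
  assumes "min_annihilator g M"
  shows "{\<theta>. poly g \<theta> = 0} = eigenvalues M"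
proof (intro set_eqI iffI)
  fix \<theta> assume "\<theta> \<in> {\<theta>. poly g \<theta> = 0}"
  then obtain h where "g = [:-\<theta>, 1:] * h"
    by (auto simp: poly_eq_0_iff_dvd elim: dvdE)
  note h = min_annihilator_cofactor[OF assms this]
  then obtain x y where "matrix_poly h M $ x $ y \<noteq> 0"
    by (auto simp: vec_eq_iff)
  then have "column y (matrix_poly h M) \<noteq> 0"
    by (auto simp: vec_eq_iff column_def)
  moreover have "M *v column y (matrix_poly h M) = \<theta> *s column y (matrix_poly h M)"
    using h(2) by (simp add: vec_eq_iff column_def matrix_vector_mult_def matrix_matrix_mult_def)
  ultimately show "\<theta> \<in> eigenvalues M"
    by (auto simp: eigenvalues_def)
next
  fix \<theta> assume "\<theta> \<in> eigenvalues M"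
  then show "\<theta> \<in> {\<theta>. poly g \<theta> = 0}"
    using assms eigenvalue_imp_root by (auto simp: min_annihilator_def)
qed

text \<open>At a double root \<open>g\<close> divides \<open>h * h\<close>, so the value of
  \<open>h\<close> at \<open>M\<close> squares to zero. Being normal it is zero, against
  minimality.\<close>

lemma normal_min_annihilator_simple_root:
  assumes "normal_matrix M" "min_annihilator g M" "g = [:-\<theta>, 1:] * h"
  shows "poly h \<theta> \<noteq> 0"
proof
  assume "poly h \<theta> = 0"
  then obtain q where "h = [:-\<theta>, 1:] * q"
    by (auto simp: poly_eq_0_iff_dvd elim: dvdE)
  then have "h * h = g * q"
    by (simp only: assms(3) ac_simps)
  then have "matrix_poly h M ** matrix_poly h M = matrix_poly g M ** matrix_poly q M"
    by (simp flip: matrix_poly_mult)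
  then have "matrix_poly h M ** matrix_poly h M = 0"
    using assms(2) by (simp add: min_annihilator_def)
  then have "matrix_poly h M = 0"
    using assms(1) normal_matrix_poly normal_matrix_square_eq_0 by blast
  with min_annihilator_cofactor[OF assms(2,3)] show False
    by simp
qed

text \<open>All roots are simple, so the degree counts them.\<close>

lemma normal_min_annihilator_degree:
  assumes "normal_matrix M" "min_annihilator g M"
  shows "degree g = card (eigenvalues M)"
proof -
  have "g \<noteq> 0"
    using assms(2) by (simp add: min_annihilator_def)
  have "rsquarefree g"
    unfolding rsquarefree_roots
  proof (intro allI notI, elim conjE)
    fix \<theta> assume \<theta>: "poly g \<theta> = 0" "poly (pderiv g) \<theta> = 0"
    then obtain h where h: "g = [:-\<theta>, 1:] * h"
      by (auto simp: poly_eq_0_iff_dvd elim: dvdE)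
    have "poly (pderiv g) \<theta> = poly h \<theta>"
      unfolding h pderiv_mult by (simp add: pderiv_pCons)
    with \<theta>(2) normal_min_annihilator_simple_root[OF assms h] show False
      by simp
  qed
  then have "smult (lead_coeff g) (\<Prod>z|poly g z = 0. [:-z, 1:]) = g"
    by (rule complex_poly_decompose_rsquarefree)
  then have "degree g = degree (smult (lead_coeff g) (\<Prod>z|poly g z = 0. [:-z, 1:]))"
    by simp
  also have "\<dots> = card {z. poly g z = 0}"
    using \<open>g \<noteq> 0\<close> by (simp add: degree_prod_eq_sum_degree)
  finally show ?thesis
    by (simp add: min_annihilator_roots[OF assms(2)])
qed

text \<open>The cofactors \<open>h \<theta>\<close>, scaled to be 1 at \<theta>, are the Lagrange
  polynomials of the eigenvalues. Their values at \<open>M\<close> sum to the identity, and the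
  adjoint of \<open>M\<close> acts on each of them as the scalar
  \<open>cnj \<theta>\<close>.\<close>

lemma conj_transpose_in_polynomial_algebra:
  fixes M :: "complex^'n^'n"
  assumes "normal_matrix M"
  shows "conj_transpose M \<in> polynomial_algebra M"
proof -
  obtain g where g: "min_annihilator g M"
    using ex_min_annihilator by blast
  define E where "E = eigenvalues M"
  have card_E: "card E = degree g"
    using normal_min_annihilator_degree[OF assms g] by (simp add: E_def)
  have "\<exists>h. g = [:-\<theta>, 1:] * h" if "\<theta> \<in> E" for \<theta>
  proof -
    have "[:-\<theta>, 1:] dvd g"
      using that min_annihilator_roots[OF g] by (auto simp: E_def simp flip: poly_eq_0_iff_dvd)
    then show ?thesis
      unfolding dvd_def .
  qed
  then obtain h where h: "g = [:-\<theta>, 1:] * h \<theta>" if "\<theta> \<in> E" for \<theta>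
    by metis
  have h_nz: "poly (h \<theta>) \<theta> \<noteq> 0" if "\<theta> \<in> E" for \<theta>
    using normal_min_annihilator_simple_root[OF assms g h[OF that]] .
  have h_z: "poly (h \<theta>) \<eta> = 0" if "\<theta> \<in> E" "\<eta> \<in> E" "\<eta> \<noteq> \<theta>" for \<theta> \<eta>
  proof -
    have "poly g \<eta> = 0"
      using that min_annihilator_roots[OF g] by (auto simp: E_def)
    then show ?thesis
      using that h[OF that(1)] by (auto simp: algebra_simps)
  qed
  have g_nz: "g \<noteq> 0"
    using g by (simp add: min_annihilator_def)
  have "finite E"
    using min_annihilator_roots[OF g] poly_roots_finite[OF g_nz] by (simp add: E_def)
  have deg_h: "degree (h \<theta>) < card E" if "\<theta> \<in> E" for \<theta>
  proof -
    have "h \<theta> \<noteq> 0"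
      using h[OF that] g_nz by auto
    then have "degree g = Suc (degree (h \<theta>))"
      by (subst h[OF that], subst degree_mult_eq) auto
    then show ?thesis
      by (simp add: card_E)
  qed
  \<comment> \<open>Positive degree means that \<open>E\<close> is nonempty, which the strict degree
    bounds for \<open>L\<close> and for the constant 1 rely on.\<close>
  have "degree g > 0"
  proof (rule ccontr)
    assume "\<not> ?thesis"
    then obtain a where a: "g = [:a:]"
      using degree_eq_zeroE by (metis neq0_conv)
    then have "smult_matrix a (mat 1) = (0 :: complex^'n^'n)" "a \<noteq> 0"
      using g by (auto simp: min_annihilator_def matrix_poly_pCons)
    then have "(smult_matrix a (mat 1) :: complex^'n^'n) $ undefined $ undefined = 0"
      by simp
    with \<open>a \<noteq> 0\<close> show False
      by (simp add: mat_def)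
  qed
  \<comment> \<open>\<open>L\<close> interpolates the constant 1 on \<open>E\<close> with degree
    below \<open>card E\<close>, hence equals 1.\<close>
  define L where "L = (\<Sum>\<theta>\<in>E. smult (inverse (poly (h \<theta>) \<theta>)) (h \<theta>))"
  have "L = 1"
  proof (rule poly_eqI_degree[where A = E])
    fix \<eta> assume \<eta>: "\<eta> \<in> E"
    have "poly L \<eta> = (\<Sum>\<theta>\<in>E. if \<theta> = \<eta> then 1 else 0)"
      unfolding L_def poly_sum using \<eta> h_nz h_z by (intro sum.cong) auto
    with \<eta> \<open>finite E\<close> show "poly L \<eta> = poly 1 \<eta>"
      by simp
  next
    show "degree L < card E"
      unfolding L_def using deg_h \<open>degree g > 0\<close> card_E
      by (intro degree_sum_less) (auto intro: le_less_trans[OF degree_smult_le])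
  qed (use \<open>degree g > 0\<close> card_E in auto)
  have "matrix_poly L M =
      (\<Sum>\<theta>\<in>E. smult_matrix (inverse (poly (h \<theta>) \<theta>)) (matrix_poly (h \<theta>) M))"
    by (simp add: L_def matrix_poly_sum matrix_poly_smult)
  then have "mat 1 = (\<Sum>\<theta>\<in>E. smult_matrix (inverse (poly (h \<theta>) \<theta>)) (matrix_poly (h \<theta>) M))"
    by (simp add: \<open>L = 1\<close>)
  then have "conj_transpose M = conj_transpose M **
      (\<Sum>\<theta>\<in>E. smult_matrix (inverse (poly (h \<theta>) \<theta>)) (matrix_poly (h \<theta>) M))"
    by (metis matrix_mul_rid)
  also have "\<dots> = (\<Sum>\<theta>\<in>E. smult_matrix (inverse (poly (h \<theta>) \<theta>))
      (conj_transpose M ** matrix_poly (h \<theta>) M))"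
    by (simp add: matrix_mult_sum_right smult_matrix_mult_right)
  also have "\<dots> \<in> polynomial_algebra M"
  proof (intro matrix_space.subspace_sum matrix_space.subspace_scale subspace_polynomial_algebra)
    fix \<theta> assume \<theta>: "\<theta> \<in> E"
    let ?N = "matrix_poly [:-\<theta>, 1:] M"
    have "?N ** matrix_poly (h \<theta>) M = 0"
      using h[OF \<theta>] g by (metis matrix_poly_mult min_annihilator_def)
    then have "conj_transpose ?N ** matrix_poly (h \<theta>) M = 0"
      using assms normal_matrix_poly normal_matrix_annihilate by blast
    then have "conj_transpose M ** matrix_poly (h \<theta>) M = smult_matrix (cnj \<theta>) (matrix_poly (h \<theta>) M)"
      by (simp add: matrix_poly_X conj_transpose_diff conj_transpose_smult matrix_diff_rdistrib
          smult_matrix_mult_left)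
    then show "conj_transpose M ** matrix_poly (h \<theta>) M \<in> polynomial_algebra M"
      by (metis polynomial_algebra_eq_range rangeI matrix_poly_smult)
  qed
  finally show ?thesis .
qed

lemma polynomial_algebra_conj_transpose:
  assumes "normal_matrix M" "P \<in> polynomial_algebra M"
  shows "conj_transpose P \<in> polynomial_algebra M"
proof -
  obtain p where "P = matrix_poly p M"
    using assms(2) by (auto simp: polynomial_algebra_def)
  moreover have "conj_transpose (matrix_poly p M) \<in> polynomial_algebra M"
  proof (induction p)
    case 0
    then show ?case
      by (simp add: matrix_space.subspace_0[OF subspace_polynomial_algebra])
  next
    case (pCons a p)
    have "mat 1 \<in> polynomial_algebra M"
      using matrix_power_in_polynomial_algebra[of M 0] by simp
    then show ?case
      using pCons.IH conj_transpose_in_polynomial_algebra[OF assms(1)]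
      by (auto simp: matrix_poly_pCons conj_transpose_add conj_transpose_smult conj_transpose_mult
          intro!: matrix_space.subspace_add matrix_space.subspace_scale
            subspace_polynomial_algebra polynomial_algebra_mult)
  qed
  ultimately show ?thesis
    by simp
qed

section \<open>Walks and distances\<close>

lemma directed_path_imp_walk:
  assumes "directed_path A x vs y"
  shows "(arc_of A ^^ (length vs - 1)) x y"
  using assms
proof (induction vs arbitrary: x)
  case (Cons a vs)
  show ?case
  proof (cases vs)
    case (Cons b ws)
    with Cons.prems have "directed_path A b vs y" "arc_of A x b"
      by (auto simp: directed_path_def)
    with Cons.IH[of b] show ?thesis
      using relpowp_Suc_I2[of "arc_of A" x b "length vs - 1" y] Cons by simp
  qed (use Cons.prems in \<open>auto simp: directed_path_def\<close>)
qed (simp add: directed_path_def)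

text \<open>If the new first vertex already lies on the path, the part before that occurrence is
  dropped to keep the vertices distinct. Hence only a bound on the length.\<close>

lemma walk_imp_directed_path:
  assumes "(arc_of A ^^ l) x y"
  shows "\<exists>vs. directed_path A x vs y \<and> length vs \<le> Suc l"
  using assms
proof (induction l arbitrary: x)
  case 0
  then show ?case
    by (intro exI[of _ "[x]"]) (auto simp: directed_path_def)
next
  case (Suc l)
  obtain z where z: "arc_of A x z" "(arc_of A ^^ l) z y"
    using relpowp_Suc_D2[OF Suc.prems] by blast
  obtain vs where vs: "directed_path A z vs y" "length vs \<le> Suc l"
    using Suc.IH[OF z(2)] by blast
  show ?case
  proof (cases "x \<in> set vs")
    case True
    then obtain us ws where "vs = us @ x # ws"
      by (meson split_list)
    with vs show ?thesis
      by (intro exI[of _ "x # ws"]) (auto simp: directed_path_def successively_append_iff)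
  next
    case False
    with vs z(1) show ?thesis
      by (intro exI[of _ "x # vs"]) (auto simp: directed_path_def successively_Cons)
  qed
qed

text \<open>Allows distances, defined by paths with distinct vertices, to be handled through
  relational powers from here on.\<close>

lemma digraph_dist_walk:
  assumes "(arc_of A ^^ l) x y"
  shows "(arc_of A ^^ digraph_dist A x y) x y" "digraph_dist A x y \<le> l"
proof -
  let ?P = "\<lambda>l. \<exists>vs. directed_path A x vs y \<and> length vs = Suc l"
  obtain vs where vs: "directed_path A x vs y" "length vs \<le> Suc l"
    using walk_imp_directed_path[OF assms] by blast
  then have P: "?P (length vs - 1)"
    by (cases vs) (auto simp: directed_path_def)
  then have "?P (digraph_dist A x y)"
    unfolding digraph_dist_def by (rule LeastI)
  then show "(arc_of A ^^ digraph_dist A x y) x y"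
    using directed_path_imp_walk by (metis diff_Suc_1)
  have "digraph_dist A x y \<le> length vs - 1"
    unfolding digraph_dist_def using P by (rule Least_le)
  with vs(2) show "digraph_dist A x y \<le> l"
    by linarith
qed

text \<open>A proper nonempty set that no arc leaves gives a zero lower left block once its
  complement is listed first.\<close>

lemma irreducible_matrix_closed_set:
  fixes B :: "real^'n^'n"
  assumes "irreducible_matrix B" "S \<noteq> {}" "\<And>x y. x \<in> S \<Longrightarrow> y \<notin> S \<Longrightarrow> B $ x $ y = 0"
  shows "S = UNIV"
proof (rule ccontr)
  assume "S \<noteq> UNIV"
  define k where "k = card (- S)"
  have k: "0 < k" "k < CARD('n)"
    using \<open>S \<noteq> UNIV\<close> \<open>S \<noteq> {}\<close> by (auto simp: k_def card_gt_0_iff intro!: psubset_card_mono)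
  have "k + card S = CARD('n)"
    using card_Un_disjoint[of "- S" S] by (simp add: k_def)
  then have "card {k..<CARD('n)} = card S"
    by simp
  then obtain e1 where e1: "bij_betw e1 {k..<CARD('n)} S"
    using finite_same_card_bij by (metis finite finite_atLeastLessThan)
  obtain e0 where e0: "bij_betw e0 {..<k} (- S)"
    using finite_same_card_bij[of "{..<k}" "- S"] by (auto simp: k_def)
  define e where "e i = (if i < k then e0 i else e1 i)" for i
  have "bij_betw e {..<k} (- S)"
    using e0 by (rule bij_betw_cong[THEN iffD1, rotated]) (simp add: e_def)
  moreover have "bij_betw e {k..<CARD('n)} S"
    using e1 by (rule bij_betw_cong[THEN iffD1, rotated]) (simp add: e_def)
  ultimately have "bij_betw e ({..<k} \<union> {k..<CARD('n)}) (- S \<union> S)"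
    by (rule bij_betw_combine) auto
  moreover have "{..<k} \<union> {k..<CARD('n)} = {..<CARD('n)}"
    using k by auto
  ultimately have e: "bij_betw e {..<CARD('n)} UNIV"
    by simp
  \<comment> \<open>The enumeration \<open>e\<close> does the reordering, so the identity serves as
    permutation matrix.\<close>
  have "permutation_matrix (mat 1 :: real^'n^'n)"
    unfolding permutation_matrix_def
    by (intro exI[of _ id]) (simp add: permutes_id vec_eq_iff mat_def)
  moreover have "(transpose (mat 1) ** B ** mat 1) $ e i $ e j = 0"
    if "i \<in> {k..<CARD('n)}" "j < k" for i j
  proof -
    have "e i \<in> S" "e j \<notin> S"
      using that e0 e1 bij_betwE by (fastforce simp: e_def)+
    then show ?thesis
      using assms(3) by simp
  qed
  ultimately have "reducible_matrix B"
    unfolding reducible_matrix_def using k e by blast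
  with assms(1) show False
    by (simp add: irreducible_matrix_def)
qed

section \<open>The digraph of a nonnegative irreducible matrix\<close>

locale nonneg_irreducible =
  fixes B :: "real^'n^'n"
  assumes nonneg: "nonneg_matrix B" and irreducible: "irreducible_matrix B"
begin

abbreviation arc :: "'n \<Rightarrow> 'n \<Rightarrow> bool" where
  "arc x y \<equiv> 0 < B $ x $ y"

abbreviation dist :: "'n \<Rightarrow> 'n \<Rightarrow> nat" where
  "dist \<equiv> digraph_dist (support_matrix B)"

abbreviation diam :: nat where
  "diam \<equiv> digraph_diameter (support_matrix B)"

abbreviation M :: "complex^'n^'n" where
  "M \<equiv> complex_matrix B"

lemma entry_nonneg: "0 \<le> B $ x $ y"
  using nonneg by (simp add: nonneg_matrix_def)

lemma arc_of_support: "arc_of (support_matrix B) = arc"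
  by (auto simp: arc_of_def support_matrix_def fun_eq_iff)

text \<open>Strong connectivity: no arc leaves the set of vertices reachable from
  \<open>x\<close>.\<close>

lemma walk_exists: "\<exists>l. (arc ^^ l) x y"
proof -
  let ?S = "{y. \<exists>l. (arc ^^ l) x y}"
  have "?S = UNIV"
  proof (rule irreducible_matrix_closed_set[OF irreducible])
    have "(arc ^^ 0) x x"
      by simp
    then show "?S \<noteq> {}"
      by blast
    fix u v assume "u \<in> ?S" "v \<notin> ?S"
    then have "\<not> arc u v"
      using relpowp_Suc_I[where P = arc] by blast
    then show "B $ u $ v = 0"
      using entry_nonneg[of u v] by simp
  qed
  then show ?thesis
    by blast
qed

lemma walk_dist: "(arc ^^ dist x y) x y"
  using walk_exists[of x y] digraph_dist_walk(1)[of _ "support_matrix B"] arc_of_support by auto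

lemma dist_le: "(arc ^^ l) x y \<Longrightarrow> dist x y \<le> l"
  using digraph_dist_walk(2)[of _ "support_matrix B"] arc_of_support by auto

lemma dist_eq_0_iff [simp]: "dist x y = 0 \<longleftrightarrow> x = y"
  using walk_dist[of x y] dist_le[of 0 x y] by auto

lemma dist_le_walk: "(arc ^^ l) x z \<Longrightarrow> dist x y \<le> l + dist z y"
  by (rule dist_le[OF relpowp_trans[OF _ walk_dist]])

lemma dist_values: "{dist x y | x y. True} = (\<lambda>(x, y). dist x y) ` UNIV"
  by auto

lemma dist_le_diam: "dist x y \<le> diam"
  unfolding digraph_diameter_def dist_values by (intro Max_ge) auto

lemma ex_dist_diam: "\<exists>x y. dist x y = diam"
proof -
  have "diam \<in> (\<lambda>(x, y). dist x y) ` UNIV"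
    unfolding digraph_diameter_def dist_values by (intro Max_in) auto
  then obtain p where "diam = dist (fst p) (snd p)"
    by (auto simp: case_prod_unfold)
  then show ?thesis
    by metis
qed

text \<open>A shortest walk is cut after \<open>j\<close> steps; the triangle inequality makes both
  pieces shortest.\<close>

lemma geodesic:
  assumes "j \<le> dist x y"
  obtains z where "(arc ^^ j) x z" "dist x z = j" "dist z y = dist x y - j"
proof -
  have "(arc ^^ (j + (dist x y - j))) x y"
    using assms walk_dist by simp
  then obtain z where z: "(arc ^^ j) x z" "(arc ^^ (dist x y - j)) z y"
    by (auto simp: relpowp_add)
  have "dist x y \<le> dist x z + dist z y"
    by (rule dist_le_walk[OF walk_dist])
  with z show ?thesis
    using dist_le[OF z(1)] dist_le[OF z(2)] assms by (intro that) auto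
qed

lemma ex_dist:
  assumes "k \<le> diam"
  obtains x y where "dist x y = k"
  using assms ex_dist_diam geodesic by metis

text \<open>Nonnegative terms cannot cancel, so an entry is positive exactly when some walk
  contributes. Realness and nonnegativity are carried along for the induction.\<close>

lemma matrix_power_entry:
  "Im (matrix_power M k $ x $ y) = 0 \<and> 0 \<le> Re (matrix_power M k $ x $ y) \<and>
   (0 < Re (matrix_power M k $ x $ y) \<longleftrightarrow> (arc ^^ k) x y)"
proof (induction k arbitrary: x)
  case 0
  then show ?case
    by (simp add: mat_def)
next
  case (Suc k)
  have entry: "matrix_power M (Suc k) $ x $ y = (\<Sum>z\<in>UNIV. of_real (B $ x $ z) * matrix_power M k $ z $ y)"
    by (simp add: matrix_power_Suc matrix_matrix_mult_def map_matrix_def)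
  have nn: "0 \<le> B $ x $ z * Re (matrix_power M k $ z $ y)" for z
    using Suc entry_nonneg by simp
  have "(0 < (\<Sum>z\<in>UNIV. B $ x $ z * Re (matrix_power M k $ z $ y))) \<longleftrightarrow>
      (\<exists>z. 0 < B $ x $ z * Re (matrix_power M k $ z $ y))"
    using nn sum_nonneg_eq_0_iff[of UNIV "\<lambda>z. B $ x $ z * Re (matrix_power M k $ z $ y)"]
    by (auto simp: order.strict_iff_order sum_nonneg)
  also have "\<dots> \<longleftrightarrow> (\<exists>z. arc x z \<and> (arc ^^ k) z y)"
    using Suc entry_nonneg by (metis mult_pos_pos mult_zero_left mult_zero_right order_less_le)
  also have "\<dots> \<longleftrightarrow> (arc ^^ Suc k) x y"
    unfolding relpowp_Suc_left by auto
  finally show ?case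
    using nn Suc by (simp add: entry sum_nonneg)
qed

lemma matrix_power_nz_iff: "matrix_power M k $ x $ y \<noteq> 0 \<longleftrightarrow> (arc ^^ k) x y"
  using matrix_power_entry[of k x y] by (auto simp: complex_eq_iff)

lemma matrix_power_eq_0: "k < dist x y \<Longrightarrow> matrix_power M k $ x $ y = 0"
  using matrix_power_nz_iff dist_le by (metis not_le)

lemma matrix_power_dist_nz: "matrix_power M (dist x y) $ x $ y \<noteq> 0"
  by (simp add: matrix_power_nz_iff walk_dist)

text \<open>Otherwise some pair is at distance \<open>degree h\<close>. There all lower powers
  vanish and the leading one does not.\<close>

lemma annihilator_degree:
  assumes "h \<noteq> 0" "matrix_poly h M = 0"
  shows "diam < degree h"
proof (rule ccontr)
  assume "\<not> ?thesis"
  then obtain x y where xy: "dist x y = degree h"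
    by (meson ex_dist not_le)
  have "0 = (\<Sum>k\<le>degree h. coeff h k * matrix_power M k $ x $ y)"
    using assms(2) by (simp add: matrix_poly_def vec_eq_iff)
  also have "\<dots> = (\<Sum>k\<in>{degree h}. coeff h k * matrix_power M k $ x $ y)"
    using xy by (intro sum.mono_neutral_right) (auto intro!: matrix_power_eq_0)
  finally show False
    using assms(1) matrix_power_dist_nz[of x y] xy by simp
qed

text \<open>Maximum principle: no arc leaves the set of vertices where \<open>v\<close> is
  maximal.\<close>

lemma real_eigenvector_const:
  assumes eigen: "\<And>x. (\<Sum>y\<in>UNIV. B $ x $ y * v y) = r * v x"
    and row: "\<And>x. (\<Sum>y\<in>UNIV. B $ x $ y) = r"
  shows "v x = (v y :: real)"
proof -
  let ?m = "Max (range v)"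
  let ?S = "{x. v x = ?m}"
  have "?S = UNIV"
  proof (rule irreducible_matrix_closed_set[OF irreducible])
    have "?m \<in> range v"
      by (rule Max_in) auto
    then obtain a where "v a = ?m"
      by (metis imageE)
    then show "?S \<noteq> {}"
      by blast
    fix a b assume ab: "a \<in> ?S" "b \<notin> ?S"
    have le: "v z \<le> v a" for z
      using ab(1) by simp
    \<comment> \<open>The eigenvalue equation and the row sum at \<open>a\<close> make this sum of
      nonnegative terms zero, so each term vanishes.\<close>
    have "(\<Sum>z\<in>UNIV. B $ a $ z * (v a - v z)) = v a * (\<Sum>z\<in>UNIV. B $ a $ z) - r * v a"
      by (simp flip: eigen add: right_diff_distrib sum_subtractf sum_distrib_left mult.commute)
    then have "(\<Sum>z\<in>UNIV. B $ a $ z * (v a - v z)) = 0"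
      by (simp add: row)
    then have "B $ a $ b * (v a - v b) = 0"
      by (subst (asm) sum_nonneg_eq_0_iff) (auto intro: mult_nonneg_nonneg entry_nonneg simp: le)
    then show "B $ a $ b = 0"
      using ab by auto
  qed
  then have "v x = ?m" "v y = ?m"
    by blast+
  then show ?thesis
    by simp
qed

text \<open>\<open>B\<close> and \<open>r\<close> are real, so the real and imaginary parts of each
  column satisfy the eigenvalue equation separately.\<close>

lemma columns_const:
  fixes N :: "complex^'n^'n"
  assumes "M ** N = smult_matrix (of_real r) N" "\<And>x. (\<Sum>y\<in>UNIV. B $ x $ y) = r"
  shows "N $ x $ z = N $ y $ z"
proof (rule complex_eqI)
  have eq: "(\<Sum>y\<in>UNIV. of_real (B $ x $ y) * N $ y $ z) = of_real r * N $ x $ z" for x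
    using assms(1) by (simp add: vec_eq_iff matrix_matrix_mult_def map_matrix_def)
  show "Re (N $ x $ z) = Re (N $ y $ z)"
    using arg_cong[OF eq, of Re] by (intro real_eigenvector_const[of _ r]) (auto simp: assms(2))
  show "Im (N $ x $ z) = Im (N $ y $ z)"
    using arg_cong[OF eq, of Im] by (intro real_eigenvector_const[of _ r]) (auto simp: assms(2))
qed

end

section \<open>Distance relations and association schemes\<close>

text \<open>Division by \<open>g\<close> leaves a remainder of degree at most
  \<open>d\<close>.\<close>

lemma polynomial_algebra_subset_span:
  assumes "g \<noteq> 0" "matrix_poly g N = 0" "degree g = Suc d"
  shows "polynomial_algebra N \<subseteq> matrix_space.span (matrix_power N ` {..d})"
proof
  fix P assume "P \<in> polynomial_algebra N"
  then obtain p where p: "P = matrix_poly p N"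
    by (auto simp: polynomial_algebra_def)
  have "P = matrix_poly (g * (p div g) + p mod g) N"
    by (simp add: p)
  also have "\<dots> = matrix_poly (p mod g) N"
    by (simp only: matrix_poly_add matrix_poly_mult assms(2)) simp
  also have "degree (p mod g) \<le> d"
    using degree_mod_less[of g p] assms(1,3) by auto
  then have "matrix_poly (p mod g) N = (\<Sum>k\<le>d. smult_matrix (coeff (p mod g) k) (matrix_power N k))"
    by (rule matrix_poly_eq_sum)
  also have "\<dots> \<in> matrix_space.span (matrix_power N ` {..d})"
    by (intro matrix_space.span_sum matrix_space.span_scale matrix_space.span_base) auto
  finally show "P \<in> matrix_space.span (matrix_power N ` {..d})" .
qed

lemma bose_mesner_subset_span:
  "bose_mesner d R \<subseteq> matrix_space.span ((\<lambda>i. relation_matrix (R i)) ` {..d})"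
proof
  fix P assume "P \<in> bose_mesner d R"
  then obtain c where P: "P = (\<Sum>i\<le>d. smult_matrix (c i) (relation_matrix (R i)))"
    by (auto simp: bose_mesner_def)
  show "P \<in> matrix_space.span ((\<lambda>i. relation_matrix (R i)) ` {..d})"
    unfolding P by (intro matrix_space.span_sum matrix_space.span_scale matrix_space.span_base imageI)
qed

lemma relation_matrix_nth [simp]:
  "(relation_matrix R :: ('a::zero_neq_one)^'n^'n) $ x $ y = (if (x, y) \<in> R then 1 else 0)"
  by (simp add: relation_matrix_def)

context nonneg_irreducible
begin

lemma distance_matrix_nth [simp]:
  "(distance_matrix (support_matrix B) i :: ('a::zero_neq_one)^'n^'n) $ x $ y =
     (if dist x y = i then 1 else 0)"
  by (simp add: distance_matrix_def)

text \<open>The row sum \<open>r\<close> is an eigenvalue, and the value \<open>N\<close> at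
  \<open>M\<close> of its cofactor turns out to be a nonzero multiple of the all-ones matrix: the
  maximum principle makes its columns constant, and normality gives the same for its rows.\<close>

lemma doubly_stochastic_all_ones:
  assumes "doubly_stochastic r B" "normal_matrix M"
  shows "(\<chi> x y. 1) \<in> polynomial_algebra M"
proof -
  have row: "(\<Sum>y\<in>UNIV. B $ x $ y) = r" for x
    using assms(1) by (simp add: doubly_stochastic_def)
  have "M *v (\<chi> x. 1) = of_real r *s (\<chi> x. 1)"
    by (simp add: vec_eq_iff matrix_vector_mult_def map_matrix_def row flip: of_real_sum)
  moreover have "(\<chi> x. 1) \<noteq> (0 :: complex^'n)"
    by (simp add: vec_eq_iff)
  ultimately have "of_real r \<in> eigenvalues M"
    by (auto simp: eigenvalues_def)
  moreover obtain g where g: "min_annihilator g M"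
    using ex_min_annihilator by blast
  ultimately have "poly g (of_real r) = 0"
    using min_annihilator_roots by blast
  then obtain h where h: "g = [:-of_real r, 1:] * h"
    by (auto simp: poly_eq_0_iff_dvd elim: dvdE)
  define N where "N = matrix_poly h M"
  have N: "N \<in> polynomial_algebra M"
    by (auto simp: N_def polynomial_algebra_def)
  have N_nz: "N \<noteq> 0" and MN: "M ** N = smult_matrix (of_real r) N"
    using min_annihilator_cofactor[OF g h] by (simp_all add: N_def)
  have "matrix_poly [:-of_real r, 1:] M ** N = 0"
    using MN by (simp add: matrix_poly_X matrix_diff_rdistrib smult_matrix_mult_left)
  then have "conj_transpose (matrix_poly [:-of_real r, 1:] M) ** N = 0"
    using assms(2) normal_matrix_poly normal_matrix_annihilate by blast
  then have "conj_transpose M ** N = smult_matrix (of_real r) N"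
    by (simp add: matrix_poly_X conj_transpose_diff conj_transpose_smult matrix_diff_rdistrib
        smult_matrix_mult_left)
  \<comment> \<open>Both factors are polynomials in \<open>M\<close> and commute. Taking adjoints
    then makes the maximum principle applicable to \<open>conj_transpose N\<close>.\<close>
  then have "N ** conj_transpose M = smult_matrix (of_real r) N"
    using polynomial_algebra_commute[OF conj_transpose_in_polynomial_algebra[OF assms(2)] N] by simp
  then have "conj_transpose (N ** conj_transpose M) = conj_transpose (smult_matrix (of_real r) N)"
    by simp
  then have "M ** conj_transpose N = smult_matrix (of_real r) (conj_transpose N)"
    by (simp add: conj_transpose_mult conj_transpose_smult)
  from columns_const[OF this row] have row_const: "N $ z $ x = N $ z $ y" for x y z
    by simp
  obtain a b where ab: "N $ a $ b \<noteq> 0"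
    using N_nz by (auto simp: vec_eq_iff)
  have "N $ x $ y = N $ a $ b" for x y
    using columns_const[OF MN row, of x y a] row_const[of a y b] by simp
  then have "inverse (N $ a $ b) * N $ x $ y = 1" for x y
    using ab by (metis left_inverse)
  then have "(\<chi> x y. 1) = smult_matrix (inverse (N $ a $ b)) N"
    by (simp add: vec_eq_iff)
  then show ?thesis
    using N by (simp add: matrix_space.subspace_scale subspace_polynomial_algebra)
qed

lemma bose_mesner_distance_nth:
  assumes "P \<in> bose_mesner diam (\<lambda>i. {(x, y). dist x y = i})"
    and "dist x y = dist x' y'"
  shows "P $ x $ y = P $ x' $ y'"
proof -
  obtain c where c: "P = (\<Sum>i\<le>diam. smult_matrix (c i) (relation_matrix {(x, y). dist x y = i}))"
    using assms(1) by (auto simp: bose_mesner_def)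
  show ?thesis
    by (simp add: c assms(2))
qed

section \<open>From the spectral conditions to the distance scheme\<close>

context
  assumes normal: "normal_matrix M"
    and card_eigenvalues: "card (eigenvalues M) = diam + 1"
begin

text \<open>The number of eigenvalues is the degree of the minimal polynomial, so
  \<open>diam + 1\<close> powers span and any independent family of that size does too.\<close>

lemma polynomial_algebra_spanning:
  assumes "\<And>k. k \<le> diam \<Longrightarrow> f k \<in> polynomial_algebra M"
    and "\<And>c. (\<Sum>k\<le>diam. smult_matrix (c k) (f k)) = 0 \<Longrightarrow> \<forall>k\<le>diam. c k = 0"
    and "P \<in> polynomial_algebra M"
  obtains c where "P = (\<Sum>k\<le>diam. smult_matrix (c k) (f k))"
proof -
  obtain g where g: "min_annihilator g M"
    using ex_min_annihilator by blast
  then have "degree g = Suc diam"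
    using normal_min_annihilator_degree[OF normal g] card_eigenvalues by simp
  then have sub: "polynomial_algebra M \<subseteq> matrix_space.span (matrix_power M ` {..diam})"
    using g by (intro polynomial_algebra_subset_span) (auto simp: min_annihilator_def)
  have "card (matrix_power M ` {..diam}) \<le> Suc diam"
    using card_image_le[of "{..diam}" "matrix_power M"] by simp
  with sub assms show ?thesis
    using that by (rule_tac matrix_family_spanning[of "matrix_power M ` {..diam}" "Suc diam" f P])
      (auto simp: lessThan_Suc_atMost less_Suc_eq_le)
qed

context
  assumes distance_diam: "distance_matrix (support_matrix B) diam \<in> polynomial_algebra M"
begin

text \<open>The powers below \<open>i\<close> live at distance less than \<open>i\<close>, the remaining matrices at
  distance at least \<open>i\<close>. Hence expanding the all-ones matrix in this basis cuts it at distance \<open>i\<close>.\<close>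

definition split_basis :: "nat \<Rightarrow> nat \<Rightarrow> complex^'n^'n" where
  "split_basis i k = (if k < i then matrix_power M k
     else conj_transpose (matrix_power M (diam - k)) ** distance_matrix (support_matrix B) diam)"

lemma split_basis_in: "split_basis i k \<in> polynomial_algebra M"
  by (simp add: split_basis_def matrix_power_in_polynomial_algebra polynomial_algebra_mult
      polynomial_algebra_conj_transpose normal distance_diam)

lemma split_basis_low: "k < i \<Longrightarrow> k < dist x y \<Longrightarrow> split_basis i k $ x $ y = 0"
  by (simp add: split_basis_def matrix_power_eq_0)

lemma split_basis_high_entry:
  assumes "i \<le> k"
  shows "split_basis i k $ x $ y =
    (\<Sum>z\<in>UNIV. cnj (matrix_power M (diam - k) $ z $ x) * (if dist z y = diam then 1 else 0))"
  using assms by (simp add: split_basis_def matrix_matrix_mult_def)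

text \<open>A nonzero summand needs a walk of length \<open>diam - k\<close> from \<open>z\<close>
  to \<open>x\<close> while \<open>z\<close> is at distance \<open>diam\<close> from
  \<open>y\<close>. That forces \<open>dist x y\<close> to be at least \<open>k\<close>.\<close>

lemma split_basis_high:
  assumes "i \<le> k" "k \<le> diam" "dist x y < k"
  shows "split_basis i k $ x $ y = 0"
  unfolding split_basis_high_entry[OF assms(1)]
proof (rule sum.neutral, intro ballI)
  fix z
  have "matrix_power M (diam - k) $ z $ x = 0" if "dist z y = diam"
  proof (rule ccontr)
    assume "\<not> ?thesis"
    then have "dist z y \<le> diam - k + dist x y"
      by (intro dist_le_walk) (simp add: matrix_power_nz_iff)
    with that assms show False
      by simp
  qed
  then show "cnj (matrix_power M (diam - k) $ z $ x) * (if dist z y = diam then 1 else 0) = 0"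
    by simp
qed

lemma split_basis_nz:
  assumes "k \<le> diam"
  obtains x y where "dist x y = k" "split_basis i k $ x $ y \<noteq> 0"
proof (cases "k < i")
  case True
  obtain x y where "dist x y = k"
    using ex_dist[OF assms] .
  with True matrix_power_dist_nz[of x y] that show ?thesis
    by (simp add: split_basis_def)
next
  case False
  obtain x y where xy: "dist x y = diam"
    using ex_dist_diam by blast
  then obtain z where z: "(arc ^^ (diam - k)) x z" "dist z y = k"
    using geodesic[of "diam - k" x y] assms by (metis diff_diff_cancel diff_le_self)
  \<comment> \<open>The vertex \<open>z\<close> lies \<open>diam - k\<close> steps along a geodesic
    from \<open>x\<close> to \<open>y\<close>. The summand \<open>u = x\<close> is positive and none
    is negative; real parts absorb the \<open>cnj\<close>.\<close>
  have "0 < (\<Sum>u\<in>UNIV. Re (matrix_power M (diam - k) $ u $ z) * (if dist u y = diam then 1 else 0))"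
    using matrix_power_entry z(1) xy
    by (intro sum_pos2[of _ x]) auto
  also have "\<dots> = Re (split_basis i k $ z $ y)"
    using False by (simp add: split_basis_high_entry if_distrib cong: if_cong)
  finally show ?thesis
    using z(2) by (intro that) auto
qed

text \<open>The supports are triangular with respect to distance, but in opposite directions below
  \<open>i\<close> and from \<open>i\<close> on, so the two halves are treated one after the
  other.\<close>

lemma split_basis_independent:
  assumes "(\<Sum>k\<le>diam. smult_matrix (c k) (split_basis i k)) = 0"
  shows "\<forall>k\<le>diam. c k = 0"
proof -
  \<comment> \<open>Evaluating the relation at a pair from \<open>split_basis_nz\<close> isolates
    \<open>c k\<close> once the other terms vanish at distance \<open>k\<close>.\<close>
  have single: "c k = 0" if k: "k \<le> diam"
    and others: "\<And>j x y. j \<le> diam \<Longrightarrow> j \<noteq> k \<Longrightarrow> dist x y = k \<Longrightarrow> c j * split_basis i j $ x $ y = 0"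
    for k
  proof -
    obtain x y where xy: "dist x y = k" "split_basis i k $ x $ y \<noteq> 0"
      using split_basis_nz[OF k] .
    have "0 = (\<Sum>j\<le>diam. c j * split_basis i j $ x $ y)"
      using arg_cong[OF assms, of "\<lambda>P. P $ x $ y"] by simp
    also have "\<dots> = (\<Sum>j\<in>{k}. c j * split_basis i j $ x $ y)"
      using k others xy(1) by (intro sum.mono_neutral_right) auto
    finally show ?thesis
      using xy(2) by simp
  qed
  \<comment> \<open>Downwards from \<open>i - 1\<close>: at distance \<open>k\<close> the powers
    below \<open>k\<close> vanish, and so do the members from \<open>i\<close> on.\<close>
  have low: "k \<le> diam \<longrightarrow> c k = 0" if "k < i" for k
    using that
  proof (induction "i - k" arbitrary: k rule: less_induct)
    case less
    show ?case
    proof (intro impI single)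
      fix j x y assume "k \<le> diam" "j \<le> diam" "j \<noteq> k" "dist x y = k"
      then show "c j * split_basis i j $ x $ y = 0"
        using less split_basis_low[of j i x y] split_basis_high[of i j x y]
        by (cases "j < k"; cases "j < i") auto
    qed
  qed
  \<comment> \<open>Upwards from \<open>i\<close>: at distance \<open>k\<close> the members beyond
    \<open>k\<close> vanish, and \<open>low\<close> removes those below \<open>i\<close>.\<close>
  have high: "k \<le> diam \<longrightarrow> c k = 0" if "i \<le> k" for k
    using that
  proof (induction k rule: less_induct)
    case (less k)
    show ?case
    proof (intro impI single)
      fix j x y assume "k \<le> diam" "j \<le> diam" "j \<noteq> k" "dist x y = k"
      then show "c j * split_basis i j $ x $ y = 0"
        using less low split_basis_high[of i j x y]
        by (cases "j < k"; cases "j < i") auto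
    qed
  qed
  show ?thesis
    using low high by (meson not_le)
qed

context
  assumes all_ones: "(\<chi> x y. 1) \<in> polynomial_algebra M"
begin

text \<open>The part of the expansion with \<open>k < i\<close> agrees with the all-ones matrix at
  distance less than \<open>i\<close> and vanishes elsewhere.\<close>

lemma distance_less_in_polynomial_algebra:
  "(\<chi> x y. if dist x y < i then 1 else 0) \<in> polynomial_algebra M" (is "?S \<in> _")
proof -
  obtain c where c: "(\<chi> x y. 1) = (\<Sum>k\<le>diam. smult_matrix (c k) (split_basis i k))"
    by (rule polynomial_algebra_spanning[OF split_basis_in split_basis_independent all_ones])
  let ?W = "\<Sum>k\<in>{k. k \<le> diam \<and> k < i}. smult_matrix (c k) (split_basis i k)"
  have "?S $ x $ y = ?W $ x $ y" for x y
  proof (cases "dist x y < i")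
    case True
    have zero: "split_basis i k $ x $ y = 0" if "k \<le> diam" "i \<le> k" for k
      using that True by (intro split_basis_high) auto
    have "1 = (\<Sum>k\<le>diam. c k * split_basis i k $ x $ y)"
      using arg_cong[OF c, of "\<lambda>P. P $ x $ y"] by simp
    also have "\<dots> = (\<Sum>k\<in>{k. k \<le> diam \<and> k < i}. c k * split_basis i k $ x $ y)"
      by (intro sum.mono_neutral_right) (auto, meson zero not_less)
    finally show ?thesis
      using True by simp
  next
    case False
    then show ?thesis
      by (auto simp: split_basis_low intro!: sum.neutral[symmetric])
  qed
  then have "?S = ?W"
    by (simp add: vec_eq_iff)
  also have "\<dots> \<in> polynomial_algebra M"
    by (intro matrix_space.subspace_sum matrix_space.subspace_scale subspace_polynomial_algebra
        split_basis_in)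
  finally show ?thesis .
qed

lemma distance_matrix_in_polynomial_algebra:
  "distance_matrix (support_matrix B) i \<in> polynomial_algebra M"
proof -
  have "distance_matrix (support_matrix B) i =
      (\<chi> x y. if dist x y < Suc i then 1 else 0) - (\<chi> x y. if dist x y < i then 1 else (0 :: complex))"
    by (auto simp: vec_eq_iff)
  then show ?thesis
    using distance_less_in_polynomial_algebra
    by (simp add: matrix_space.subspace_diff subspace_polynomial_algebra)
qed

text \<open>The distance matrices have disjoint nonempty supports, hence are independent, and there
  are \<open>diam + 1\<close> of them.\<close>

lemma polynomial_algebra_eq_bose_mesner:
  "polynomial_algebra M = bose_mesner diam (\<lambda>i. {(x, y). dist x y = i})"
proof
  let ?A = "\<lambda>i. relation_matrix {(x, y). dist x y = i} :: complex^'n^'n"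
  have A: "?A i \<in> polynomial_algebra M" for i
    using distance_matrix_in_polynomial_algebra[of i] by (simp add: distance_matrix_def)
  show "bose_mesner diam (\<lambda>i. {(x, y). dist x y = i}) \<subseteq> polynomial_algebra M"
    unfolding bose_mesner_def
    by (auto intro!: matrix_space.subspace_sum matrix_space.subspace_scale
        subspace_polynomial_algebra A)
  have "\<forall>k\<le>diam. c k = 0" if "(\<Sum>k\<le>diam. smult_matrix (c k) (?A k)) = 0" for c
  proof (intro allI impI)
    fix k assume "k \<le> diam"
    moreover then obtain x y where "dist x y = k"
      using ex_dist by blast
    ultimately show "c k = 0"
      using arg_cong[OF that, of "\<lambda>P. P $ x $ y"] by (simp add: if_distrib cong: if_cong)
  qed
  then show "polynomial_algebra M \<subseteq> bose_mesner diam (\<lambda>i. {(x, y). dist x y = i})"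
    unfolding bose_mesner_def using polynomial_algebra_spanning[of ?A] A by blast
qed

text \<open>Closure under transposition amounts to \<open>dist y x\<close> being determined by
  \<open>dist x y\<close>. This holds because the algebra contains adjoints and its members are
  constant on each distance.\<close>

lemma commutative_scheme_distance:
  "commutative_scheme diam (\<lambda>i. {(x, y). dist x y = i})"
proof -
  let ?R = "\<lambda>i. {(x, y). dist x y = i}"
  let ?A = "\<lambda>i. relation_matrix (?R i) :: complex^'n^'n"
  have A: "?A i \<in> polynomial_algebra M" for i
    using distance_matrix_in_polynomial_algebra[of i] by (simp add: distance_matrix_def)
  have dist_swap: "dist u v = dist y x" if "dist v u = dist x y" for u v x y
  proof -
    \<comment> \<open>This matrix is 1 at \<open>(x, y)\<close>, hence also at
      \<open>(v, u)\<close>.\<close>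
    have "conj_transpose (?A (dist y x)) \<in> bose_mesner diam ?R"
      using polynomial_algebra_conj_transpose[OF normal A] polynomial_algebra_eq_bose_mesner by simp
    from bose_mesner_distance_nth[OF this that] show ?thesis
      by (simp split: if_splits)
  qed
  have "transpose (?A i) \<in> ?A ` {..diam}" if i: "i \<le> diam" for i
  proof -
    obtain x y where xy: "dist x y = i"
      using ex_dist[OF i] .
    have "dist v u = i \<longleftrightarrow> dist u v = dist y x" for u v
      using dist_swap xy by metis
    then have "transpose (?A i) = ?A (dist y x)"
      by (simp add: vec_eq_iff transpose_def)
    then show ?thesis
      using dist_le_diam by blast
  qed
  moreover have "?R i \<noteq> {}" if "i \<le> diam" for i
    using ex_dist[OF that] by blast
  moreover have "?A 0 = mat 1"
    by (simp add: vec_eq_iff mat_def)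
  moreover have "(\<Sum>i\<le>diam. ?A i) = (\<chi> x y. 1)"
    by (simp add: vec_eq_iff dist_le_diam)
  moreover have "?A i ** ?A j \<in> bose_mesner diam ?R" for i j
    using polynomial_algebra_mult[OF A A] polynomial_algebra_eq_bose_mesner by simp
  moreover have "?A i ** ?A j = ?A j ** ?A i" for i j
    by (rule polynomial_algebra_commute[OF A A])
  ultimately show ?thesis
    by (simp only: commutative_scheme_def Let_def) blast
qed

end

end

end

section \<open>From a scheme to the spectral conditions\<close>

context
  fixes R
  assumes scheme: "commutative_scheme diam R"
    and algebra: "polynomial_algebra M = bose_mesner diam R"
begin

lemma scheme_relation_in: "i \<le> diam \<Longrightarrow> relation_matrix (R i) \<in> polynomial_algebra M"
  unfolding algebra bose_mesner_def
  by (auto simp: if_distrib[of "\<lambda>c. smult_matrix c _"] cong: if_cong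
      intro!: exI[of _ "\<lambda>j. if j = i then 1 else 0"])

lemma scheme_all_ones: "(\<chi> x y. 1) \<in> polynomial_algebra M"
proof -
  have "((\<chi> x y. 1) :: complex^'n^'n) = (\<Sum>i\<le>diam. relation_matrix (R i))"
    using scheme by (simp add: commutative_scheme_def Let_def)
  also have "\<dots> \<in> polynomial_algebra M"
    by (intro matrix_space.subspace_sum subspace_polynomial_algebra scheme_relation_in) simp
  finally show ?thesis .
qed

text \<open>Comparing entries of the products with the all-ones matrix equates every row sum with
  every column sum.\<close>

lemma scheme_doubly_stochastic: "\<exists>r. doubly_stochastic r B"
proof -
  have eq: "M ** (\<chi> x y. 1) = (\<chi> x y. 1) ** M"
    by (rule polynomial_algebra_commute[OF matrix_in_polynomial_algebra scheme_all_ones])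
  have "(\<Sum>z\<in>UNIV. B $ x $ z) = (\<Sum>z\<in>UNIV. B $ z $ y)" for x y
  proof -
    have "complex_of_real (\<Sum>z\<in>UNIV. B $ x $ z) = complex_of_real (\<Sum>z\<in>UNIV. B $ z $ y)"
      using arg_cong[OF eq, of "\<lambda>P. P $ x $ y"] by (simp add: matrix_matrix_mult_def map_matrix_def)
    then show ?thesis
      by (simp only: of_real_eq_iff)
  qed
  then show ?thesis
    unfolding doubly_stochastic_def using nonneg by metis
qed

text \<open>The adjoint lies in the commutative algebra: since \<open>B\<close> is real, it is the
  transpose, and the coefficients \<open>c i\<close> stay unconjugated.\<close>

lemma scheme_normal: "normal_matrix M"
proof -
  obtain c where c: "M = (\<Sum>i\<le>diam. smult_matrix (c i) (relation_matrix (R i)))"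
    using matrix_in_polynomial_algebra[of M] unfolding algebra bose_mesner_def by blast
  have "conj_transpose M = (\<Sum>i\<le>diam. smult_matrix (c i) (transpose (relation_matrix (R i))))"
  proof -
    have "conj_transpose M $ x $ y =
        (\<Sum>i\<le>diam. smult_matrix (c i) (transpose (relation_matrix (R i)))) $ x $ y" for x y
    proof -
      have "conj_transpose M $ x $ y = complex_of_real (B $ y $ x)"
        by simp
      also have "\<dots> = (\<Sum>i\<le>diam. c i * (if (y, x) \<in> R i then 1 else 0))"
        using arg_cong[OF c, of "\<lambda>P. P $ y $ x"] by simp
      finally show ?thesis
        by (simp add: transpose_def del: conj_transpose_nth)
    qed
    then show ?thesis
      unfolding vec_eq_iff by blast
  qed
  also have "\<dots> \<in> polynomial_algebra M"
  proof (intro matrix_space.subspace_sum matrix_space.subspace_scale subspace_polynomial_algebra)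
    fix i assume "i \<in> {..diam}"
    then have "transpose (relation_matrix (R i)) \<in>
        (\<lambda>i. relation_matrix (R i) :: complex^'n^'n) ` {..diam}"
      using scheme by (simp add: commutative_scheme_def Let_def)
    then show "transpose (relation_matrix (R i)) \<in> polynomial_algebra M"
      using scheme_relation_in by auto
  qed
  finally show ?thesis
    unfolding normal_matrix_def
    by (rule polynomial_algebra_commute[OF matrix_in_polynomial_algebra])
qed

text \<open>The number of eigenvalues is the degree of the minimal polynomial. The adjacency
  matrices bound it from above, distances in the digraph from below.\<close>

lemma scheme_card_eigenvalues: "card (eigenvalues M) = diam + 1"
proof -
  obtain g where g: "min_annihilator g M"
    using ex_min_annihilator by blast
  let ?T = "(\<lambda>i. relation_matrix (R i) :: complex^'n^'n) ` {..diam}"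
  have "card ?T \<le> Suc diam"
    using card_image_le[of "{..diam}" "\<lambda>i. relation_matrix (R i) :: complex^'n^'n"] by simp
  moreover have "matrix_power M k \<in> matrix_space.span ?T" for k
    using matrix_power_in_polynomial_algebra[of M k] bose_mesner_subset_span algebra by blast
  ultimately obtain h where h: "h \<noteq> 0" "matrix_poly h M = 0" "degree h \<le> Suc diam"
    using annihilating_poly_of_span[of ?T "Suc diam" M] by auto
  have "degree g \<le> Suc diam"
    using g h unfolding min_annihilator_def by (meson order.trans)
  moreover have "diam < degree g"
    using g annihilator_degree by (simp add: min_annihilator_def)
  ultimately show ?thesis
    using normal_min_annihilator_degree[OF scheme_normal g] by simp
qed

text \<open>Powers of \<open>M\<close> are constant on each relation, and the first power that is
  nonzero at a pair shows its distance. So each relation lies within a single distance.\<close>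

lemma scheme_distance_diam: "distance_matrix (support_matrix B) diam \<in> polynomial_algebra M"
proof -
  have "\<exists>!i. i \<le> diam \<and> (x, y) \<in> R i" for x y
  proof -
    have "(\<Sum>i\<le>diam. relation_matrix (R i)) = ((\<chi> x y. 1) :: complex^'n^'n)"
      using scheme by (simp add: commutative_scheme_def Let_def)
    from arg_cong[OF this, of "\<lambda>P. P $ x $ y"]
    have "(\<Sum>i\<le>diam. if (x, y) \<in> R i then 1 else 0 :: complex) = 1"
      by simp
    \<comment> \<open>The sum of indicators counts the relations that contain
      \<open>(x, y)\<close>.\<close>
    then have "of_nat (card {i. i \<le> diam \<and> (x, y) \<in> R i}) = (1 :: complex)"
      by (simp add: sum.If_cases Int_def)
    then have "card {i. i \<le> diam \<and> (x, y) \<in> R i} = 1"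
      by (simp only: of_nat_eq_1_iff)
    then obtain a where "{i. i \<le> diam \<and> (x, y) \<in> R i} = {a}"
      by (auto simp: card_1_singleton_iff)
    then show ?thesis
      by (intro ex1I[of _ a]) blast+
  qed
  then obtain rel where rel: "\<And>x y i. i \<le> diam \<and> (x, y) \<in> R i \<longleftrightarrow> i = rel x y"
    by metis
  have entry: "(\<Sum>i\<le>diam. smult_matrix (c i) (relation_matrix (R i))) $ x $ y = c (rel x y)" for c x y
  proof -
    have "(\<Sum>i\<le>diam. smult_matrix (c i) (relation_matrix (R i))) $ x $ y =
        (\<Sum>i\<le>diam. if i = rel x y then c i else 0)"
      unfolding sum_component by (intro sum.cong) (auto simp flip: rel)
    moreover have "rel x y \<le> diam"
      using rel by blast
    ultimately show ?thesis
      by simp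
  qed
  have le: "dist x y \<le> dist x' y'" if "rel x y = rel x' y'" for x y x' y'
  proof -
    \<comment> \<open>This power is nonzero at \<open>(x', y')\<close>, hence at
      \<open>(x, y)\<close>, which yields a walk of that length.\<close>
    have "matrix_power M (dist x' y') \<in> bose_mesner diam R"
      using matrix_power_in_polynomial_algebra algebra by blast
    then have "matrix_power M (dist x' y') $ x $ y = matrix_power M (dist x' y') $ x' $ y'"
      using entry that by (auto simp: bose_mesner_def)
    then show ?thesis
      using matrix_power_nz_iff walk_dist dist_le by metis
  qed
  \<comment> \<open>Selects the relations containing some pair at distance \<open>diam\<close>; by
    \<open>le\<close> in both directions all their pairs are at that distance.\<close>
  let ?c = "\<lambda>i. if \<exists>x y. rel x y = i \<and> dist x y = diam then 1 else 0"
  have diam_iff: "dist x y = diam \<longleftrightarrow> (\<exists>x' y'. rel x' y' = rel x y \<and> dist x' y' = diam)" for x y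
    using le by (metis antisym)
  have "distance_matrix (support_matrix B) diam $ x $ y =
      (\<Sum>i\<le>diam. smult_matrix (?c i) (relation_matrix (R i))) $ x $ y" for x y
    unfolding entry distance_matrix_nth by (rule if_cong[OF diam_iff refl refl])
  then have "distance_matrix (support_matrix B) diam =
      (\<Sum>i\<le>diam. smult_matrix (?c i) (relation_matrix (R i)))"
    unfolding vec_eq_iff by blast
  then show ?thesis
    unfolding algebra bose_mesner_def by (intro CollectI exI[of _ ?c] conjI TrueI)
qed

end

end

theorem theorem1p2:
  fixes B A :: "real^'n^'n" and D :: nat and \<B> :: "(complex^'n^'n) set"
  assumes "nonneg_matrix B" and "irreducible_matrix B"
    and "\<B> = polynomial_algebra (complex_matrix B)"
    and "A = support_matrix B"
    and "D = digraph_diameter A"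
  shows "(\<exists>R. commutative_scheme D R \<and> \<B> = bose_mesner D R) \<longleftrightarrow>
         ((\<exists>r::real. doubly_stochastic r B) \<and> normal_matrix (complex_matrix B) \<and>
          card (eigenvalues (complex_matrix B)) = D + 1 \<and>
          distance_matrix A D \<in> \<B>)"
proof -
  interpret nonneg_irreducible B
    by unfold_locales (use assms in auto)
  show ?thesis
    unfolding assms(3-5)
  proof
    assume "\<exists>R. commutative_scheme diam R \<and> polynomial_algebra M = bose_mesner diam R"
    then show "(\<exists>r. doubly_stochastic r B) \<and> normal_matrix M \<and> card (eigenvalues M) = diam + 1 \<and>
        distance_matrix (support_matrix B) diam \<in> polynomial_algebra M"
      using scheme_doubly_stochastic scheme_normal scheme_card_eigenvalues scheme_distance_diam
      by metis
  next
    assume "(\<exists>r. doubly_stochastic r B) \<and> normal_matrix M \<and> card (eigenvalues M) = diam + 1 \<and>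
        distance_matrix (support_matrix B) diam \<in> polynomial_algebra M"
    then show "\<exists>R. commutative_scheme diam R \<and> polynomial_algebra M = bose_mesner diam R"
      using commutative_scheme_distance polynomial_algebra_eq_bose_mesner doubly_stochastic_all_ones
      by metis
  qed
qed

end
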